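(* For every infinite cardinal $\lambda$ the discrete semigroup $\mathscr{I}^{\infty}_\lambda$ does not embed into a compact Hausdorff topological semigroup.
   Context: For an infinite cardinal $\lambda$ (regarded as a set), $\mathscr{I}_\lambda$ is the symmetric inverse semigroup of all partial one-to-one maps from $\lambda$ to $\lambda$; maps are written on the right and composed left to right: $(x)(\alpha\beta)=((x)\alpha)\beta$ for $x\in\operatorname{dom}(\alpha\beta)=\{y\in\operatorname{dom}\alpha\mid (y)\alpha\in\operatorname{dom}\beta\}$. A map $\alpha\in\mathscr{I}_\lambda$ is almost everywhere the identity if $\lambda\setminus\operatorname{dom}\alpha$ is finite and $(x)\alpha\neq x$ only for finitely many $x\in\operatorname{dom}\alpha$. $\mathscr{I}^{\infty}_\lambda\subseteq\mathscr{I}_\lambda$ is the inverse subsemigroup of all such maps. A topological semigroup is a topological space with a jointly continuous semigroup operation. The discrete semigroup $\mathscr{I}^{\infty}_\lambda$ (i.e. with the discrete topology) embeds into a topological semigroup $S$ if there is an injective semigroup homomorphism into $S$ that is a homeomorphism onto its image. *)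

theory Defs
  imports "HOL-Analysis.Analysis"
begin

definition symmetric_inverse_semigroup :: "'a set \<Rightarrow> ('a \<rightharpoonup> 'a) set" where
  "symmetric_inverse_semigroup X =
     {\<alpha>. dom \<alpha> \<subseteq> X \<and> ran \<alpha> \<subseteq> X \<and> inj_on \<alpha> (dom \<alpha>)}"

(* Maps act on the right, so the product applies \<alpha> first; the library's \<circ>\<^sub>m applies its
   right argument first. *)
definition pmult :: "('a \<rightharpoonup> 'a) \<Rightarrow> ('a \<rightharpoonup> 'a) \<Rightarrow> ('a \<rightharpoonup> 'a)" where
  "pmult \<alpha> \<beta> = \<beta> \<circ>\<^sub>m \<alpha>"

definition almost_everywhere_identity :: "'a set \<Rightarrow> ('a \<rightharpoonup> 'a) \<Rightarrow> bool" where
  "almost_everywhere_identity X \<alpha> \<longleftrightarrow>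
     finite (X - dom \<alpha>) \<and> finite {x \<in> dom \<alpha>. \<alpha> x \<noteq> Some x}"

definition I_infty :: "'a set \<Rightarrow> ('a \<rightharpoonup> 'a) set" where
  "I_infty X = {\<alpha> \<in> symmetric_inverse_semigroup X. almost_everywhere_identity X \<alpha>}"

(* The type class topological_semigroup_mult only covers semigroups that exhaust a type;
   here the underlying set is the topspace of an arbitrary topology. *)
definition topological_semigroup :: "'b topology \<Rightarrow> ('b \<Rightarrow> 'b \<Rightarrow> 'b) \<Rightarrow> bool" where
  "topological_semigroup T m \<longleftrightarrow>
     (\<forall>x \<in> topspace T. \<forall>y \<in> topspace T. m x y \<in> topspace T) \<and>
     (\<forall>x \<in> topspace T. \<forall>y \<in> topspace T. \<forall>z \<in> topspace T. m (m x y) z = m x (m y z)) \<and>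
     continuous_map (prod_topology T T) T (\<lambda>(x, y). m x y)"

definition semigroup_embedding ::
    "'a topology \<Rightarrow> ('a \<Rightarrow> 'a \<Rightarrow> 'a) \<Rightarrow> 'b topology \<Rightarrow> ('b \<Rightarrow> 'b \<Rightarrow> 'b) \<Rightarrow> ('a \<Rightarrow> 'b) \<Rightarrow> bool" where
  "semigroup_embedding S mS T mT h \<longleftrightarrow>
     (\<forall>x \<in> topspace S. \<forall>y \<in> topspace S. h (mS x y) = mT (h x) (h y)) \<and>
     embedding_map S T h"

definition embeds_into ::
    "'a topology \<Rightarrow> ('a \<Rightarrow> 'a \<Rightarrow> 'a) \<Rightarrow> 'b topology \<Rightarrow> ('b \<Rightarrow> 'b \<Rightarrow> 'b) \<Rightarrow> bool" where
  "embeds_into S mS T mT \<longleftrightarrow> (\<exists>h. semigroup_embedding S mS T mT h)"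

lemma dom_pmult: "dom (pmult \<alpha> \<beta>) = {y \<in> dom \<alpha>. the (\<alpha> y) \<in> dom \<beta>}"
  by (auto simp: pmult_def map_comp_def split: option.splits)

lemma pmult_apply: "x \<in> dom (pmult \<alpha> \<beta>) \<Longrightarrow> pmult \<alpha> \<beta> x = \<beta> (the (\<alpha> x))"
  by (auto simp: pmult_def map_comp_def split: option.splits)

lemma pmult_assoc: "pmult (pmult \<alpha> \<beta>) \<gamma> = pmult \<alpha> (pmult \<beta> \<gamma>)"
  by (rule ext) (auto simp: pmult_def map_comp_def split: option.splits)

lemma I_infty_pmult_closed:
  assumes "\<alpha> \<in> I_infty X" and "\<beta> \<in> I_infty X"
  shows "pmult \<alpha> \<beta> \<in> I_infty X"
proof -
  let ?A = "(X - dom \<alpha>) \<union> {x \<in> dom \<alpha>. \<alpha> x \<noteq> Some x}"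
  let ?B = "(X - dom \<beta>) \<union> {x \<in> dom \<beta>. \<beta> x \<noteq> Some x}"
  have a: "dom \<alpha> \<subseteq> X" "ran \<alpha> \<subseteq> X" "inj_on \<alpha> (dom \<alpha>)" "finite ?A"
    and b: "dom \<beta> \<subseteq> X" "ran \<beta> \<subseteq> X" "inj_on \<beta> (dom \<beta>)" "finite ?B"
    using assms
    by (auto simp: I_infty_def symmetric_inverse_semigroup_def almost_everywhere_identity_def)
  have fixed: "pmult \<alpha> \<beta> x = Some x" if "x \<in> X" "x \<notin> ?A \<union> ?B" for x
    using that by (auto simp: pmult_def map_comp_def)
  have d: "dom (pmult \<alpha> \<beta>) \<subseteq> X"
    using a(1) by (auto simp: dom_pmult)
  have r: "ran (pmult \<alpha> \<beta>) \<subseteq> X"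
    using b(2) by (auto simp: ran_def pmult_def map_comp_Some_iff)
  have i: "inj_on (pmult \<alpha> \<beta>) (dom (pmult \<alpha> \<beta>))"
  proof (rule inj_onI)
    fix x y
    assume x: "x \<in> dom (pmult \<alpha> \<beta>)" and y: "y \<in> dom (pmult \<alpha> \<beta>)"
      and eq: "pmult \<alpha> \<beta> x = pmult \<alpha> \<beta> y"
    from x obtain u v where u: "\<alpha> x = Some u" "\<beta> u = Some v"
      by (auto simp: pmult_def map_comp_Some_iff)
    from y eq u obtain w where w: "\<alpha> y = Some w" "\<beta> w = Some v"
      by (auto simp: pmult_def map_comp_Some_iff)
    have "u = w" using b(3) u w by (metis domI inj_onD)
    then show "x = y" using a(3) u w by (metis domI inj_onD)
  qed
  have f1: "finite (X - dom (pmult \<alpha> \<beta>))"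
    by (rule finite_subset[of _ "?A \<union> ?B"]) (use fixed a(4) b(4) in \<open>blast+\<close>)
  have f2: "finite {x \<in> dom (pmult \<alpha> \<beta>). pmult \<alpha> \<beta> x \<noteq> Some x}"
    by (rule finite_subset[of _ "?A \<union> ?B"]) (use fixed d a(4) b(4) in \<open>blast+\<close>)
  show ?thesis
    using d r i f1 f2
    by (simp add: I_infty_def symmetric_inverse_semigroup_def almost_everywhere_identity_def)
qed

lemma topological_semigroup_I_infty:
  "topological_semigroup (discrete_topology (I_infty X)) pmult"
  by (auto simp: topological_semigroup_def I_infty_pmult_closed pmult_assoc
      simp flip: prod_topology_discrete_topology)

end

theory Submission
  imports Defs
begin

text \<open>
  An infinite family of involutions (here, the transpositions moving a fixed point \<open>a\<close>)
  accumulates in a compact semigroup at some \<open>x\<close>, and \<open>x x\<close> is the image \<open>e\<close> of the identity.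
  As \<open>e\<close> is isolated in the image of the semigroup, \<open>s t = e\<close> for any two involutions \<open>s\<close>, \<open>t\<close>
  of the family close enough to \<open>x\<close>, hence \<open>s = t\<close>, which contradicts accumulation.
\<close>

text \<open>Joint continuity at the point \<open>(x, x)\<close> gives a product neighbourhood
  \<open>A\<close> times \<open>B\<close> mapped into \<open>U\<close>; intersecting the two factors
  yields a single \<open>W\<close> that serves both arguments.\<close>

lemma topological_semigroup_nhd_square:
  assumes "topological_semigroup T m" "x \<in> topspace T" "openin T U" "m x x \<in> U"
  obtains W where "openin T W" "x \<in> W" "\<And>y z. y \<in> W \<Longrightarrow> z \<in> W \<Longrightarrow> m y z \<in> U"
proof -
  let ?P = "{p \<in> topspace (prod_topology T T). (case p of (x, y) \<Rightarrow> m x y) \<in> U}"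
  have "openin (prod_topology T T) ?P"
    using assms(1,3) by (intro openin_continuous_map_preimage) (simp_all add: topological_semigroup_def)
  moreover have "(x, x) \<in> ?P"
    using assms by simp
  ultimately have "\<exists>A B. openin T A \<and> openin T B \<and> x \<in> A \<and> x \<in> B \<and> A \<times> B \<subseteq> ?P"
    unfolding openin_prod_topology_alt by (elim allE impE)
  then obtain A B where AB: "openin T A" "openin T B" "x \<in> A" "x \<in> B" "A \<times> B \<subseteq> ?P"
    by (elim exE conjE)
  show thesis
  proof
    show "openin T (A \<inter> B)" "x \<in> A \<inter> B"
      using AB by auto
    show "m y z \<in> U" if "y \<in> A \<inter> B" "z \<in> A \<inter> B" for y z
      using subsetD[OF AB(5), of "(y, z)"] that by simp
  qed
qed

text \<open>Near an accumulation point of \<open>S\<close>, all products, not just squares, fall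
  into \<open>U\<close>. The lemma is meant for a \<open>U\<close> that isolates the common square
  \<open>e\<close> within an embedded semigroup, where it forces \<open>m s t = e\<close> for
  distinct \<open>s\<close> and \<open>t\<close>.\<close>

lemma compact_semigroup_no_separated_involutions:
  assumes sg: "topological_semigroup T m" and cpt: "compact_space T" and t1: "t1_space T"
    and S: "S \<subseteq> topspace T" "infinite S" "\<And>s. s \<in> S \<Longrightarrow> m s s = e"
    and U: "openin T U" "e \<in> U"
  obtains s t where "s \<in> S" "t \<in> S" "s \<noteq> t" "m s t \<in> U"
proof -
  have "topspace T \<inter> T derived_set_of S \<noteq> {}"
    by (rule compactin_imp_Bolzano_Weierstrass[OF cpt[unfolded compact_space_def] conjI[OF S(2,1)]])
  then obtain x where x: "x \<in> topspace T"
    and acc: "\<And>V. x \<in> V \<Longrightarrow> openin T V \<Longrightarrow> \<exists>y\<in>S. y \<noteq> x \<and> y \<in> V"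
    by (force simp: derived_set_of_def)
  \<comment> \<open>The squares pass to the limit: otherwise the complement of \<open>e\<close>,
    open by the T1 property, would contain the square of every point near \<open>x\<close>,
    including points of \<open>S\<close>.\<close>
  have xx: "m x x = e"
  proof (rule ccontr)
    assume ne: "m x x \<noteq> e"
    have mem: "m x x \<in> topspace T"
      using sg x by (auto simp: topological_semigroup_def)
    have "e \<in> topspace T"
      using U openin_subset by blast
    then have "openin T (topspace T - {e})"
      using t1 by (simp add: t1_space_closedin_singleton openin_diff)
    then obtain W where W: "openin T W" "x \<in> W"
      "\<And>y z. y \<in> W \<Longrightarrow> z \<in> W \<Longrightarrow> m y z \<in> topspace T - {e}"
      using topological_semigroup_nhd_square[OF sg x] ne mem by blast
    then obtain s where "s \<in> S" "s \<in> W"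
      using acc[of W] by blast
    with W(3)[of s s] S(3) show False
      by auto
  qed
  obtain W where W: "openin T W" "x \<in> W" "\<And>y z. y \<in> W \<Longrightarrow> z \<in> W \<Longrightarrow> m y z \<in> U"
    using topological_semigroup_nhd_square[OF sg x U(1)] xx U(2) by metis
  then obtain s where s: "s \<in> S" "s \<noteq> x" "s \<in> W"
    using acc[of W] by blast
  \<comment> \<open>Since \<open>s\<close> differs from \<open>x\<close>, removing it leaves a
    neighbourhood of \<open>x\<close>, in which accumulation supplies a second point of
    \<open>S\<close>.\<close>
  have "openin T (W - {s})"
    using t1 s S(1) W(1) by (auto simp: t1_space_closedin_singleton)
  then obtain t where "t \<in> S" "t \<in> W - {s}"
    using acc[of "W - {s}"] W(2) s(2) by blast
  with s W(3) show thesis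
    by (auto intro: that[of s t])
qed

text \<open>The case \<open>b = a\<close> is the identity map on \<open>X\<close>, so the identity
  of the semigroup is written \<open>ptransp X a a\<close>.\<close>

definition ptransp :: "'a set \<Rightarrow> 'a \<Rightarrow> 'a \<Rightarrow> ('a \<rightharpoonup> 'a)" where
  "ptransp X a b = (\<lambda>x. if x \<in> X then Some (Transposition.transpose a b x) else None)"

lemma dom_ptransp [simp]: "dom (ptransp X a b) = X"
  by (auto simp: ptransp_def dom_def)

lemma ptransp_in_I_infty:
  assumes "a \<in> X" "b \<in> X"
  shows "ptransp X a b \<in> I_infty X"
proof -
  have "ran (ptransp X a b) \<subseteq> X"
    using assms by (auto simp: ptransp_def ran_def Transposition.transpose_def split: if_splits)
  moreover have "inj_on (ptransp X a b) X"
    by (auto simp: ptransp_def inj_on_def dest: injD[OF inj_transpose])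
  moreover have "finite {x \<in> X. ptransp X a b x \<noteq> Some x}"
    by (rule finite_subset[of _ "{a, b}"]) (auto simp: ptransp_def Transposition.transpose_def)
  ultimately show ?thesis
    by (simp add: I_infty_def symmetric_inverse_semigroup_def almost_everywhere_identity_def)
qed

lemma pmult_ptransp_self:
  assumes "a \<in> X" "b \<in> X"
  shows "pmult (ptransp X a b) (ptransp X a b) = ptransp X a a"
  using assms by (auto simp: pmult_def map_comp_def ptransp_def fun_eq_iff Transposition.transpose_def)

text \<open>Follow the point \<open>a\<close>: the first factor moves it to \<open>b\<close>, and
  the second brings \<open>b\<close> back to \<open>a\<close> only if \<open>b = c\<close>.\<close>

lemma pmult_ptransp_eq_identD:
  assumes "a \<in> X" "b \<in> X" "pmult (ptransp X a b) (ptransp X a c) = ptransp X a a"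
  shows "b = c"
  using fun_cong[OF assms(3), of a] assms(1,2)
  by (auto simp: pmult_def map_comp_def ptransp_def Transposition.transpose_def split: if_splits)

theorem corollary5p8:
  fixes lam :: "'a rel"
    and T :: "'b topology" and m :: "'b \<Rightarrow> 'b \<Rightarrow> 'b"
  assumes "Cinfinite lam"
    and "topological_semigroup T m" and "compact_space T" and "Hausdorff_space T"
  shows "\<not> embeds_into (discrete_topology (I_infty (Field lam))) pmult T m"
proof
  define X where "X = Field lam"
  define I where "I = I_infty X"
  assume "embeds_into (discrete_topology (I_infty (Field lam))) pmult T m"
  then obtain h where hom: "\<And>x y. x \<in> I \<Longrightarrow> y \<in> I \<Longrightarrow> h (pmult x y) = m (h x) (h y)"
    and emb: "embedding_map (discrete_topology I) T h"
    by (auto simp: embeds_into_def semigroup_embedding_def I_def X_def)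
  have inf: "infinite X"
    using assms(1) by (simp add: cinfinite_def X_def)
  then obtain a where a: "a \<in> X"
    by fastforce
  define e where "e = ptransp X a a"
  have tI: "ptransp X a b \<in> I" if "b \<in> X" for b
    using ptransp_in_I_infty[OF a that] by (simp add: I_def)
  have eI: "e \<in> I"
    using tI a by (simp add: e_def)
  have hm: "homeomorphic_map (discrete_topology I) (subtopology T (h ` I)) h"
    using emb by (simp add: embedding_map_def)
  have inj: "inj_on h I"
    using homeomorphic_imp_injective_map[OF hm] by simp
  have "continuous_map (discrete_topology I) T h"
    by (rule continuous_map_into_fulltopology[OF homeomorphic_imp_continuous_map[OF hm]])
  then have im: "h ` I \<subseteq> topspace T"
    by (auto dest: continuous_map_image_subset_topspace)
  have "openin (discrete_topology I) {e}"
    using eI by simp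
  then have "openin (subtopology T (h ` I)) (h ` {e})"
    using homeomorphic_imp_open_map[OF hm] by (simp only: open_map_def)
  then obtain U where U: "openin T U" "h ` {e} = U \<inter> h ` I"
    unfolding openin_subtopology by (elim exE conjE) (rule that)
  \<comment> \<open>If two of the transpositions agree, their product is a square, hence the
    identity, and the lemma on such products applies. Injectivity lets \<open>S\<close> inherit the
    infinity of \<open>X\<close>.\<close>
  have t_inj: "inj_on (ptransp X a) X"
  proof (rule inj_onI)
    fix b c
    assume "b \<in> X" "c \<in> X" "ptransp X a b = ptransp X a c"
    then show "b = c"
      using pmult_ptransp_self[OF a, of b] pmult_ptransp_eq_identD[OF a, of b c] by simp
  qed
  define S where "S = (h \<circ> ptransp X a) ` X"
  have "inj_on (h \<circ> ptransp X a) X"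
    using t_inj inj_on_subset[OF inj, of "ptransp X a ` X"] tI by (blast intro: comp_inj_on)
  then have S_inf: "infinite S"
    using inf unfolding S_def by (simp only: finite_image_iff not_False_eq_True)
  have S_sub: "S \<subseteq> topspace T"
    using im tI by (auto simp: S_def)
  have S_sq: "m s s = h e" if "s \<in> S" for s
  proof -
    from that obtain b where b: "b \<in> X" "s = h (ptransp X a b)"
      by (auto simp: S_def)
    then show ?thesis
      using hom[OF tI tI, of b b] pmult_ptransp_self[OF a] by (simp add: e_def)
  qed
  have "h e \<in> U"
    using U(2) by blast
  then obtain s t where st: "s \<in> S" "t \<in> S" "s \<noteq> t" "m s t \<in> U"
    using compact_semigroup_no_separated_involutions
        [OF assms(2,3) Hausdorff_imp_t1_space[OF assms(4)] S_sub S_inf S_sq U(1)]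
    by blast
  then obtain b c where bc: "b \<in> X" "c \<in> X" "s = h (ptransp X a b)" "t = h (ptransp X a c)"
    by (auto simp: S_def)
  \<comment> \<open>The equation is pulled back to \<open>I\<close>: \<open>h p\<close> lies in both
    \<open>U\<close> and the image, so it equals \<open>h e\<close>, and injectivity of
    \<open>h\<close> gives \<open>p = e\<close>.\<close>
  define p where "p = pmult (ptransp X a b) (ptransp X a c)"
  have pI: "p \<in> I"
    unfolding p_def I_def
    by (intro I_infty_pmult_closed ptransp_in_I_infty a bc(1,2))
  have "m s t = h p"
    using hom[OF tI[OF bc(1)] tI[OF bc(2)]] by (simp only: p_def bc(3,4))
  then have "h p \<in> U"
    using st(4) by (simp only:)
  then have "h p \<in> h ` {e}"
    unfolding U(2) using pI by (intro IntI imageI)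
  then have "h p = h e"
    by simp
  then have "p = e"
    by (rule inj_onD[OF inj _ pI eI])
  then have "b = c"
    unfolding p_def e_def by (rule pmult_ptransp_eq_identD[OF a bc(1)])
  then show False
    using st(3) bc by simp
qed

end
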